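(* Let $\mathbf{C}$ be a model category, and let $I$ be a class of maps of $\mathbf{C}$ such that $I\text{-}\mathrm{cof}$ is the class of cofibrations of $\mathbf{C}$. Let $f : X \to Y$ be a morphism of $\mathbf{C}$ such that $X$ and $Y$ are fibrant. Then the following conditions are equivalent: (1) $f$ is a weak equivalence. (2) $f$ has the right lifting property (RLP) up to $\sim_i$ with respect to every cofibration $i$. (3) $f$ has the RLP up to $\sim_i$ with respect to every $i \in I$.
   Context: A model category is a complete and cocomplete category with three classes of maps (fibrations, cofibrations, weak equivalences) such that weak equivalences satisfy 2-out-of-3 and (cofibrations, trivial fibrations) and (trivial cofibrations, fibrations) are weak factorization systems. An object is fibrant if its map to the terminal object is a fibration. For a class $I$ of maps, $I\text{-}\mathrm{inj}$ is the class of maps having the RLP with respect to all maps in $I$, and $I\text{-}\mathrm{cof}$ is the class of maps having the left lifting property with respect to all maps in $I\text{-}\mathrm{inj}$. For each map $i : U \to V$ in a model category, $C_U(V)$ denotes the relative cylinder object with maps $\iota_0,\iota_1 : V \to C_U(V)$ obtained by factoring $[\mathrm{id}_V,\mathrm{id}_V] : V \amalg_U V \to V$ into a cofibration $[\iota_0,\iota_1] : V \amalg_U V \to C_U(V)$ followed by a trivial fibration $s : C_U(V) \to V$. For maps $a,b : V \to Y$, write $a \sim_i b$ if there is a map $h : C_U(V) \to Y$ with $h \circ \iota_0 = a$ and $h \circ \iota_1 = b$. A map $f : X \to Y$ has the RLP up to $\sim_i$ with respect to $i : U \to V$ if for all $u : U \to X$ and $v : V \to Y$ with $f \circ u = v \circ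 i$ there is a map $k : V \to X$ with $k \circ i = u$ and $f \circ k \sim_i v$. *)

theory Defs
  imports Main
begin

unbundle cardinal_syntax

section \<open>Categories\<close>

record ('o, 'm) cat =
  Obj :: "'o set"
  Arr :: "'m set"
  Src :: "'m \<Rightarrow> 'o"
  Tgt :: "'m \<Rightarrow> 'o"
  Ident :: "'o \<Rightarrow> 'm"
  Comp :: "'m \<Rightarrow> 'm \<Rightarrow> 'm"  (infixl "\<cdot>\<index>" 70)

definition hom :: "('o, 'm, 'z) cat_scheme \<Rightarrow> 'o \<Rightarrow> 'o \<Rightarrow> 'm set" where
  "hom C a b = {f \<in> Arr C. Src C f = a \<and> Tgt C f = b}"

locale category =
  fixes C :: "('o, 'm, 'z) cat_scheme" (structure)
  assumes Src_in_Obj: "f \<in> Arr C \<Longrightarrow> Src C f \<in> Obj C"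
    and Tgt_in_Obj: "f \<in> Arr C \<Longrightarrow> Tgt C f \<in> Obj C"
    and Ident_in_hom: "a \<in> Obj C \<Longrightarrow> Ident C a \<in> hom C a a"
    and Comp_in_hom: "\<lbrakk>f \<in> hom C a b; g \<in> hom C b c\<rbrakk> \<Longrightarrow> g \<cdot> f \<in> hom C a c"
    and Comp_Ident: "f \<in> hom C a b \<Longrightarrow> f \<cdot> Ident C a = f"
    and Ident_Comp: "f \<in> hom C a b \<Longrightarrow> Ident C b \<cdot> f = f"
    and Comp_assoc: "\<lbrakk>f \<in> hom C a b; g \<in> hom C b c; h \<in> hom C c d\<rbrakk>
          \<Longrightarrow> (h \<cdot> g) \<cdot> f = h \<cdot> (g \<cdot> f)"

locale functor_between =
  J: category J + C: category C
  for J :: "('jo, 'jm, 'y) cat_scheme" (structure)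
    and C :: "('o, 'm, 'z) cat_scheme" (structure) +
  fixes FO :: "'jo \<Rightarrow> 'o" and FM :: "'jm \<Rightarrow> 'm"
  assumes FO_in_Obj: "j \<in> Obj J \<Longrightarrow> FO j \<in> Obj C"
    and FM_in_hom: "t \<in> hom J j k \<Longrightarrow> FM t \<in> hom C (FO j) (FO k)"
    and FM_Ident: "j \<in> Obj J \<Longrightarrow> FM (Ident J j) = Ident C (FO j)"
    and FM_Comp: "\<lbrakk>t \<in> hom J j k; r \<in> hom J k l\<rbrakk>
          \<Longrightarrow> FM (r \<cdot>\<^bsub>J\<^esub> t) = FM r \<cdot>\<^bsub>C\<^esub> FM t"


section \<open>Limits and colimits\<close>

definition is_cone ::
  "('jo, 'jm, 'y) cat_scheme \<Rightarrow> ('o, 'm, 'z) cat_scheme \<Rightarrow> ('jo \<Rightarrow> 'o) \<Rightarrow> ('jm \<Rightarrow> 'm)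
    \<Rightarrow> 'o \<Rightarrow> ('jo \<Rightarrow> 'm) \<Rightarrow> bool" where
  "is_cone J C FO FM x l \<longleftrightarrow> x \<in> Obj C \<and> (\<forall>j\<in>Obj J. l j \<in> hom C x (FO j)) \<and>
     (\<forall>t\<in>Arr J. FM t \<cdot>\<^bsub>C\<^esub> l (Src J t) = l (Tgt J t))"

definition is_limit ::
  "('jo, 'jm, 'y) cat_scheme \<Rightarrow> ('o, 'm, 'z) cat_scheme \<Rightarrow> ('jo \<Rightarrow> 'o) \<Rightarrow> ('jm \<Rightarrow> 'm)
    \<Rightarrow> 'o \<Rightarrow> ('jo \<Rightarrow> 'm) \<Rightarrow> bool" where
  "is_limit J C FO FM x l \<longleftrightarrow> is_cone J C FO FM x l \<and>
     (\<forall>y k. is_cone J C FO FM y k \<longrightarrow>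
        (\<exists>!h. h \<in> hom C y x \<and> (\<forall>j\<in>Obj J. l j \<cdot>\<^bsub>C\<^esub> h = k j)))"

definition is_cocone ::
  "('jo, 'jm, 'y) cat_scheme \<Rightarrow> ('o, 'm, 'z) cat_scheme \<Rightarrow> ('jo \<Rightarrow> 'o) \<Rightarrow> ('jm \<Rightarrow> 'm)
    \<Rightarrow> 'o \<Rightarrow> ('jo \<Rightarrow> 'm) \<Rightarrow> bool" where
  "is_cocone J C FO FM x l \<longleftrightarrow> x \<in> Obj C \<and> (\<forall>j\<in>Obj J. l j \<in> hom C (FO j) x) \<and>
     (\<forall>t\<in>Arr J. l (Tgt J t) \<cdot>\<^bsub>C\<^esub> FM t = l (Src J t))"

definition is_colimit ::
  "('jo, 'jm, 'y) cat_scheme \<Rightarrow> ('o, 'm, 'z) cat_scheme \<Rightarrow> ('jo \<Rightarrow> 'o) \<Rightarrow> ('jm \<Rightarrow> 'm)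
    \<Rightarrow> 'o \<Rightarrow> ('jo \<Rightarrow> 'm) \<Rightarrow> bool" where
  "is_colimit J C FO FM x l \<longleftrightarrow> is_cocone J C FO FM x l \<and>
     (\<forall>y k. is_cocone J C FO FM y k \<longrightarrow>
        (\<exists>!h. h \<in> hom C x y \<and> (\<forall>j\<in>Obj J. h \<cdot>\<^bsub>C\<^esub> l j = k j)))"

text \<open>
  HOL has no built-in size distinction, so ``small'' is relative to a cardinal
  \<open>\<kappa>\<close>: a category is small when it has fewer than \<open>\<kappa>\<close> arrows (hence fewer than
  \<open>\<kappa>\<close> objects).  The small sets of a Grothendieck universe are the case where
  \<open>\<kappa>\<close> is the cardinality of that universe.  Every category of size less than \<open>\<kappa>\<close>
  is isomorphic to one whose objects and arrows lie in the field of \<open>\<kappa>\<close>, so it is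
  no restriction to take them from the type \<open>'k\<close> over which \<open>\<kappa>\<close> is defined.
\<close>

definition complete_category :: "'k rel \<Rightarrow> ('o, 'm, 'z) cat_scheme \<Rightarrow> bool" where
  "complete_category \<kappa> C \<longleftrightarrow>
     (\<forall>(J :: ('k, 'k) cat) FO FM. |Arr J| <o \<kappa> \<longrightarrow> functor_between J C FO FM \<longrightarrow>
        (\<exists>x l. is_limit J C FO FM x l))"

definition cocomplete_category :: "'k rel \<Rightarrow> ('o, 'm, 'z) cat_scheme \<Rightarrow> bool" where
  "cocomplete_category \<kappa> C \<longleftrightarrow>
     (\<forall>(J :: ('k, 'k) cat) FO FM. |Arr J| <o \<kappa> \<longrightarrow> functor_between J C FO FM \<longrightarrow>
        (\<exists>x l. is_colimit J C FO FM x l))"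

definition is_terminal :: "('o, 'm, 'z) cat_scheme \<Rightarrow> 'o \<Rightarrow> bool" where
  "is_terminal C t \<longleftrightarrow> t \<in> Obj C \<and> (\<forall>a\<in>Obj C. \<exists>!m. m \<in> hom C a t)"

definition is_pushout :: "('o, 'm, 'z) cat_scheme \<Rightarrow> 'm \<Rightarrow> 'm \<Rightarrow> 'm \<Rightarrow> 'm \<Rightarrow> bool" where
  "is_pushout C f g p q \<longleftrightarrow>
     f \<in> Arr C \<and> g \<in> Arr C \<and> p \<in> Arr C \<and> q \<in> Arr C \<and> Src C f = Src C g \<and>
     Src C p = Tgt C f \<and> Src C q = Tgt C g \<and> Tgt C p = Tgt C q \<and>
     p \<cdot>\<^bsub>C\<^esub> f = q \<cdot>\<^bsub>C\<^esub> g \<and>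
     (\<forall>y. \<forall>a\<in>hom C (Tgt C f) y. \<forall>b\<in>hom C (Tgt C g) y. a \<cdot>\<^bsub>C\<^esub> f = b \<cdot>\<^bsub>C\<^esub> g \<longrightarrow>
        (\<exists>!h. h \<in> hom C (Tgt C p) y \<and> h \<cdot>\<^bsub>C\<^esub> p = a \<and> h \<cdot>\<^bsub>C\<^esub> q = b))"


section \<open>Lifting properties\<close>

definition has_lifting :: "('o, 'm, 'z) cat_scheme \<Rightarrow> 'm \<Rightarrow> 'm \<Rightarrow> bool" where
  "has_lifting C i p \<longleftrightarrow>
     (\<forall>u\<in>hom C (Src C i) (Src C p). \<forall>v\<in>hom C (Tgt C i) (Tgt C p).
        p \<cdot>\<^bsub>C\<^esub> u = v \<cdot>\<^bsub>C\<^esub> i \<longrightarrow>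
        (\<exists>h\<in>hom C (Tgt C i) (Src C p). h \<cdot>\<^bsub>C\<^esub> i = u \<and> p \<cdot>\<^bsub>C\<^esub> h = v))"

definition llp :: "('o, 'm, 'z) cat_scheme \<Rightarrow> 'm set \<Rightarrow> 'm set" where
  "llp C R = {i \<in> Arr C. \<forall>p\<in>R. has_lifting C i p}"

definition rlp :: "('o, 'm, 'z) cat_scheme \<Rightarrow> 'm set \<Rightarrow> 'm set" where
  "rlp C L = {p \<in> Arr C. \<forall>i\<in>L. has_lifting C i p}"

definition inj_class :: "('o, 'm, 'z) cat_scheme \<Rightarrow> 'm set \<Rightarrow> 'm set" where
  "inj_class C I = rlp C I"

definition cof_class :: "('o, 'm, 'z) cat_scheme \<Rightarrow> 'm set \<Rightarrow> 'm set" where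
  "cof_class C I = llp C (inj_class C I)"

definition weak_factorization_system ::
  "('o, 'm, 'z) cat_scheme \<Rightarrow> 'm set \<Rightarrow> 'm set \<Rightarrow> bool" where
  "weak_factorization_system C L R \<longleftrightarrow> L = llp C R \<and> R = rlp C L \<and>
     (\<forall>f\<in>Arr C. \<exists>l\<in>L. \<exists>r\<in>R. Tgt C l = Src C r \<and> f = r \<cdot>\<^bsub>C\<^esub> l)"


section \<open>Model categories\<close>

record ('o, 'm) model_cat = "('o, 'm) cat" +
  Fib :: "'m set"
  Cof :: "'m set"
  Weq :: "'m set"

locale model_category = category M
  for \<kappa> :: "'k rel" and M :: "('o, 'm, 'z) model_cat_scheme" (structure) +
  assumes complete: "complete_category \<kappa> M"
    and cocomplete: "cocomplete_category \<kappa> M"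
    and Weq_subset: "Weq M \<subseteq> Arr M"
    and Weq_Comp: "\<lbrakk>f \<in> hom M a b; g \<in> hom M b c; f \<in> Weq M; g \<in> Weq M\<rbrakk> \<Longrightarrow> g \<cdot> f \<in> Weq M"
    and Weq_cancel_right: "\<lbrakk>f \<in> hom M a b; g \<in> hom M b c; f \<in> Weq M; g \<cdot> f \<in> Weq M\<rbrakk> \<Longrightarrow> g \<in> Weq M"
    and Weq_cancel_left: "\<lbrakk>f \<in> hom M a b; g \<in> hom M b c; g \<in> Weq M; g \<cdot> f \<in> Weq M\<rbrakk> \<Longrightarrow> f \<in> Weq M"
    and wfs_Cof: "weak_factorization_system M (Cof M) (Fib M \<inter> Weq M)"
    and wfs_Fib: "weak_factorization_system M (Cof M \<inter> Weq M) (Fib M)"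

definition fibrant :: "('o, 'm, 'z) model_cat_scheme \<Rightarrow> 'o \<Rightarrow> bool" where
  "fibrant M X \<longleftrightarrow> (\<exists>t. is_terminal M t \<and> (\<exists>m\<in>hom M X t. m \<in> Fib M))"


section \<open>Relative cylinders and lifting up to homotopy\<close>

record 'm rel_cylinder =
  cyl_in0 :: 'm
  cyl_in1 :: 'm
  cyl_proj :: 'm

text \<open>
  In the next definition \<open>p\<close> and \<open>q\<close> exhibit their common target as \<open>V \<amalg>\<^sub>U V\<close>,
  the map \<open>c\<close> is \<open>[\<iota>\<^sub>0, \<iota>\<^sub>1]\<close>, and the last two equations say that \<open>s \<circ> c\<close> is
  the codiagonal.  The cylinder object itself is the target of \<open>\<iota>\<^sub>0\<close>.
\<close>

definition is_rel_cylinder ::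
  "('o, 'm, 'z) model_cat_scheme \<Rightarrow> 'm \<Rightarrow> 'm rel_cylinder \<Rightarrow> bool" where
  "is_rel_cylinder M i K \<longleftrightarrow>
     (\<exists>p q c. is_pushout M i i p q \<and> c \<in> Cof M \<and> Src M c = Tgt M p \<and>
        c \<cdot>\<^bsub>M\<^esub> p = cyl_in0 K \<and> c \<cdot>\<^bsub>M\<^esub> q = cyl_in1 K \<and>
        cyl_proj K \<in> Fib M \<inter> Weq M \<and> cyl_proj K \<in> hom M (Tgt M c) (Tgt M i) \<and>
        (cyl_proj K \<cdot>\<^bsub>M\<^esub> c) \<cdot>\<^bsub>M\<^esub> p = Ident M (Tgt M i) \<and>
        (cyl_proj K \<cdot>\<^bsub>M\<^esub> c) \<cdot>\<^bsub>M\<^esub> q = Ident M (Tgt M i))"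

text \<open>
  Factorizations are not assumed to be functorial, so the assignment of a relative
  cylinder to each map is an arbitrary choice, carried around as a parameter.
\<close>

definition rel_cylinder_choice ::
  "('o, 'm, 'z) model_cat_scheme \<Rightarrow> ('m \<Rightarrow> 'm rel_cylinder) \<Rightarrow> bool" where
  "rel_cylinder_choice M cyl \<longleftrightarrow> (\<forall>i\<in>Arr M. is_rel_cylinder M i (cyl i))"

definition rel_homotopic ::
  "('o, 'm, 'z) model_cat_scheme \<Rightarrow> ('m \<Rightarrow> 'm rel_cylinder) \<Rightarrow> 'm \<Rightarrow> 'm \<Rightarrow> 'm \<Rightarrow> bool" where
  "rel_homotopic M cyl i a b \<longleftrightarrow>
     (\<exists>h\<in>hom M (Tgt M (cyl_in0 (cyl i))) (Tgt M a).
        h \<cdot>\<^bsub>M\<^esub> cyl_in0 (cyl i) = a \<and> h \<cdot>\<^bsub>M\<^esub> cyl_in1 (cyl i) = b)"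

definition has_rlp_upto_homotopy ::
  "('o, 'm, 'z) model_cat_scheme \<Rightarrow> ('m \<Rightarrow> 'm rel_cylinder) \<Rightarrow> 'm \<Rightarrow> 'm \<Rightarrow> bool" where
  "has_rlp_upto_homotopy M cyl f i \<longleftrightarrow>
     (\<forall>u\<in>hom M (Src M i) (Src M f). \<forall>v\<in>hom M (Tgt M i) (Tgt M f).
        f \<cdot>\<^bsub>M\<^esub> u = v \<cdot>\<^bsub>M\<^esub> i \<longrightarrow>
        (\<exists>k\<in>hom M (Tgt M i) (Src M f).
           k \<cdot>\<^bsub>M\<^esub> i = u \<and> rel_homotopic M cyl i (f \<cdot>\<^bsub>M\<^esub> k) v))"

end

theory Submission
  imports Defs
begin

text \<open>
  Two observations on a trivial cofibration \<open>j : X \<rightarrow> Z\<close> between fibrant objects carry the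
  proof. First, \<open>j\<close> is the inclusion of a deformation retract: it has a retraction \<open>r\<close>, and
  \<open>j r\<close> is homotopic to \<open>id\<^sub>Z\<close> relative to \<open>j\<close>, because \<open>Z \<amalg>\<^sub>X Z \<rightarrow> C\<^sub>X(Z)\<close> is then a trivial
  cofibration and \<open>[j r, id]\<close> extends along it (\<open>TrivCof_deformation_retract\<close>). Secondly,
  relative homotopies can be composed with maps on the left and restricted along commutative
  squares on the right.

  If \<open>f\<close> is a weak equivalence, write \<open>f = p j\<close> with \<open>j\<close> a trivial cofibration and \<open>p\<close> a trivial
  fibration. A square from a cofibration \<open>i\<close> to \<open>f\<close> has a strict lift \<open>k\<close> against \<open>p\<close>, and
  \<open>r k\<close> is a lift against \<open>f\<close> up to \<open>\<sim>\<^sub>i\<close>, since \<open>f r k = p (j r) k \<sim>\<^sub>i p k\<close>.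

  Every generator is a cofibration, so lifting up to homotopy against cofibrations specializes
  to generators. For the converse let \<open>f = p j\<close> with \<open>j\<close> a trivial cofibration and \<open>p\<close> only a
  fibration. It suffices to solve a strict lifting problem \<open>(u, v)\<close> of a generator
  \<open>i : U \<rightarrow> V\<close> against \<open>p\<close>, since the maps with the right lifting property against the
  generators are the trivial fibrations. The problem \<open>(u, v)\<close> is first deformed to one that comes
  from \<open>X\<close>: along the homotopy from \<open>p j r\<close> to \<open>p\<close>, the map \<open>v\<close> moves to some \<open>v\<^sub>0\<close> with
  \<open>v\<^sub>0 i = f (r u)\<close>. The hypothesis gives \<open>k\<close> with \<open>k i = r u\<close> and \<open>f k \<sim>\<^sub>i v\<^sub>0\<close>. As \<open>p\<close> is a
  fibration, this last homotopy lifts and turns \<open>j k\<close> into a strict lift of \<open>v\<^sub>0\<close>; lifting the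
  deformation from \<open>v\<^sub>0\<close> back to \<open>v\<close> turns that into a lift of \<open>v\<close>
  (\<open>homotopy_lift_imp_lift\<close>).

  The deformation between \<open>v\<close> and \<open>v\<^sub>0\<close> takes place on an object \<open>E\<close>, built by gluing a copy of \<open>W = Z \<amalg>\<^sub>U V\<close> to each
  end of \<open>C\<^sub>X(Z)\<close> and factoring the collapse map to \<open>W\<close> (\<open>glued_cylinder\<close>). Both inclusions
  \<open>C\<^sub>X(Z) \<amalg>\<^sub>Z W \<rightarrow> E\<close> are trivial cofibrations, which is homotopy extension from either end.
\<close>

section \<open>Arrows and lifting problems\<close>

context category
begin

lemma homI: "\<lbrakk>f \<in> Arr C; Src C f = a; Tgt C f = b\<rbrakk> \<Longrightarrow> f \<in> hom C a b"
  by (simp add: hom_def)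

lemma homD: 
  assumes "f \<in> hom C a b"
  shows "f \<in> Arr C" "Src C f = a" "Tgt C f = b" "a \<in> Obj C" "b \<in> Obj C"
  using assms Src_in_Obj Tgt_in_Obj by (auto simp: hom_def)

lemma lift_in_square:
  assumes "has_lifting C i p" "i \<in> hom C a b" "p \<in> hom C x y"
    "u \<in> hom C a x" "v \<in> hom C b y" "p \<cdot> u = v \<cdot> i"
  obtains h where "h \<in> hom C b x" "h \<cdot> i = u" "p \<cdot> h = v"
  using assms unfolding has_lifting_def by (metis homD(2,3))

lemma has_liftingI:
  assumes "i \<in> hom C a b" "p \<in> hom C x y"
    and "\<And>u v. \<lbrakk>u \<in> hom C a x; v \<in> hom C b y; p \<cdot> u = v \<cdot> i\<rbrakk>
          \<Longrightarrow> \<exists>h\<in>hom C b x. h \<cdot> i = u \<and> p \<cdot> h = v"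
  shows "has_lifting C i p"
  using assms unfolding has_lifting_def by (metis homD(2,3))

lemma has_lifting_Ident:
  assumes "a \<in> Obj C" "p \<in> hom C x y"
  shows "has_lifting C (Ident C a) p"
  using Ident_in_hom[OF assms(1)] assms(2)
  by (rule has_liftingI) (metis Comp_Ident)

lemma has_lifting_Comp_left:
  assumes i: "i \<in> hom C a b" and j: "j \<in> hom C b c" and p: "p \<in> hom C x y"
    and Li: "has_lifting C i p" and Lj: "has_lifting C j p"
  shows "has_lifting C (j \<cdot> i) p"
proof (rule has_liftingI[OF Comp_in_hom[OF i j] p])
  fix u v assume u: "u \<in> hom C a x" and v: "v \<in> hom C c y" and e: "p \<cdot> u = v \<cdot> (j \<cdot> i)"
  have "p \<cdot> u = (v \<cdot> j) \<cdot> i" using e Comp_assoc[OF i j v] by simp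
  then obtain g where g: "g \<in> hom C b x" "g \<cdot> i = u" "p \<cdot> g = v \<cdot> j"
    using lift_in_square[OF Li i p u Comp_in_hom[OF j v]] by blast
  obtain h where h: "h \<in> hom C c x" "h \<cdot> j = g" "p \<cdot> h = v"
    using lift_in_square[OF Lj j p g(1) v g(3)] .
  have "h \<cdot> (j \<cdot> i) = u" using Comp_assoc[OF i j h(1)] h(2) g(2) by simp
  then show "\<exists>h\<in>hom C c x. h \<cdot> (j \<cdot> i) = u \<and> p \<cdot> h = v" using h by blast
qed

lemma has_lifting_Comp_right:
  assumes i: "i \<in> hom C a b" and p: "p \<in> hom C x y" and q: "q \<in> hom C y z"
    and Lp: "has_lifting C i p" and Lq: "has_lifting C i q"
  shows "has_lifting C i (q \<cdot> p)"
proof (rule has_liftingI[OF i Comp_in_hom[OF p q]])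
  fix u v assume u: "u \<in> hom C a x" and v: "v \<in> hom C b z" and e: "q \<cdot> p \<cdot> u = v \<cdot> i"
  have "q \<cdot> (p \<cdot> u) = v \<cdot> i" using e Comp_assoc[OF u p q] by simp
  then obtain g where g: "g \<in> hom C b y" "g \<cdot> i = p \<cdot> u" "q \<cdot> g = v"
    using lift_in_square[OF Lq i q Comp_in_hom[OF u p] v] by blast
  obtain h where h: "h \<in> hom C b x" "h \<cdot> i = u" "p \<cdot> h = g"
    using lift_in_square[OF Lp i p u g(1) g(2)[symmetric]] .
  have "q \<cdot> p \<cdot> h = v" using Comp_assoc[OF h(1) p q] h(3) g(3) by simp
  then show "\<exists>h\<in>hom C b x. h \<cdot> i = u \<and> q \<cdot> p \<cdot> h = v" using h by blast
qed

lemma pushoutD: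
  assumes "is_pushout C f g p q" "f \<in> hom C a b" "g \<in> hom C a c"
  shows "p \<in> hom C b (Tgt C p)" "q \<in> hom C c (Tgt C p)" "p \<cdot> f = q \<cdot> g"
  using assms by (auto simp: is_pushout_def hom_def)

lemma pushout_sym:
  assumes "is_pushout C f g p q"
  shows "is_pushout C g f q p"
proof -
  have "\<exists>!h. h \<in> hom C (Tgt C q) y \<and> h \<cdot> q = b \<and> h \<cdot> p = a"
    if "b \<in> hom C (Tgt C g) y" "a \<in> hom C (Tgt C f) y" "b \<cdot> g = a \<cdot> f" for y a b
  proof -
    have "\<exists>!h. h \<in> hom C (Tgt C p) y \<and> h \<cdot> p = a \<and> h \<cdot> q = b"
      using assms that(1,2) that(3)[symmetric] unfolding is_pushout_def by blast
    moreover have "Tgt C p = Tgt C q" using assms unfolding is_pushout_def by simp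
    ultimately show ?thesis by (simp add: conj_commute)
  qed
  then show ?thesis using assms unfolding is_pushout_def by simp
qed

lemma pushout_desc:
  assumes "is_pushout C f g p q" "f \<in> hom C a b" "g \<in> hom C a c" "p \<in> hom C b d"
    "x \<in> hom C b y" "z \<in> hom C c y" "x \<cdot> f = z \<cdot> g"
  obtains h where "h \<in> hom C d y" "h \<cdot> p = x" "h \<cdot> q = z"
proof -
  have "\<exists>!h. h \<in> hom C (Tgt C p) y \<and> h \<cdot> p = x \<and> h \<cdot> q = z"
    using assms(1)[unfolded is_pushout_def homD(3)[OF assms(2)] homD(3)[OF assms(3)]] assms(5-7)
    by blast
  then show thesis using that homD(3)[OF assms(4)] by auto
qed

lemma pushout_ext:
  assumes P: "is_pushout C f g p q" and f: "f \<in> hom C a b" and g: "g \<in> hom C a c"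
    and p: "p \<in> hom C b d"
    and h: "h \<in> hom C d y" "h' \<in> hom C d y" "h \<cdot> p = h' \<cdot> p" "h \<cdot> q = h' \<cdot> q"
  shows "h = h'"
proof -
  have q: "q \<in> hom C c d" using pushoutD(2)[OF P f g] homD(3)[OF p] by simp
  have e: "(h \<cdot> p) \<cdot> f = (h \<cdot> q) \<cdot> g"
    using Comp_assoc[OF f p h(1)] Comp_assoc[OF g q h(1)] pushoutD(3)[OF P f g] by simp
  have "\<exists>!k. k \<in> hom C (Tgt C p) y \<and> k \<cdot> p = h \<cdot> p \<and> k \<cdot> q = h \<cdot> q"
    using P e Comp_in_hom[OF p h(1)] Comp_in_hom[OF q h(1)] homD(3)[OF f] homD(3)[OF g]
    unfolding is_pushout_def by blast
  then show ?thesis using h homD(3)[OF p] by auto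
qed

lemma has_lifting_pushout:
  assumes P: "is_pushout C f g p q" and f: "f \<in> hom C a b" and g: "g \<in> hom C a c"
    and p: "p \<in> hom C b d"
    and t: "t \<in> hom C x y" and L: "has_lifting C g t"
  shows "has_lifting C p t"
proof (rule has_liftingI[OF p t])
  have q: "q \<in> hom C c d" using pushoutD(2)[OF P f g] homD(3)[OF p] by simp
  fix u v assume u: "u \<in> hom C b x" and v: "v \<in> hom C d y" and e: "t \<cdot> u = v \<cdot> p"
  have "t \<cdot> (u \<cdot> f) = (v \<cdot> q) \<cdot> g"
    using Comp_assoc[OF f u t] Comp_assoc[OF f p v] Comp_assoc[OF g q v]
      pushoutD(3)[OF P f g] e by simp
  then obtain k where k: "k \<in> hom C c x" "k \<cdot> g = u \<cdot> f" "t \<cdot> k = v \<cdot> q"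
    using lift_in_square[OF L g t Comp_in_hom[OF f u] Comp_in_hom[OF q v]] by blast
  obtain h where h: "h \<in> hom C d x" "h \<cdot> p = u" "h \<cdot> q = k"
    using pushout_desc[OF P f g p u k(1) k(2)[symmetric]] .
  have "t \<cdot> h = v"
    by (rule pushout_ext[OF P f g p Comp_in_hom[OF h(1) t] v])
      (simp_all add: Comp_assoc[OF p h(1) t] Comp_assoc[OF q h(1) t] h k e)
  then show "\<exists>h\<in>hom C d x. h \<cdot> p = u \<and> t \<cdot> h = v" using h by blast
qed

end

section \<open>Pushouts from cocompleteness\<close>

text \<open>
  The walking span \<open>1 \<leftarrow> 0 \<rightarrow> 2\<close>. Its objects and arrows are the images of five numbers under an
  injection \<open>e\<close>, since cocompleteness quantifies over diagram shapes in an abstract type.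
  The numbers 0, 1, 2 serve both as objects and as their identities; a composite with one of the
  two other arrows is that arrow, which gives the formula for composition.
\<close>
definition span_shape :: "(nat \<Rightarrow> 'k) \<Rightarrow> ('k, 'k) cat" where
  "span_shape e = \<lparr>Obj = {e 0, e 1, e 2}, Arr = {e 0, e 1, e 2, e 3, e 4},
     Src = (\<lambda>t. if t = e 3 \<or> t = e 4 then e 0 else t),
     Tgt = (\<lambda>t. if t = e 3 then e 1 else if t = e 4 then e 2 else t),
     Ident = (\<lambda>x. x),
     Comp = (\<lambda>g f. if g = e 3 \<or> g = e 4 then g else f)\<rparr>"

lemma span_shape_simps:
  assumes "inj e"
  shows "Obj (span_shape e) = {e 0, e 1, e 2}" "Arr (span_shape e) = {e 0, e 1, e 2, e 3, e 4}"
    "Src (span_shape e) (e 0) = e 0" "Src (span_shape e) (e 1) = e 1"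
    "Src (span_shape e) (e 2) = e 2" "Src (span_shape e) (e 3) = e 0"
    "Src (span_shape e) (e 4) = e 0" "Tgt (span_shape e) (e 0) = e 0"
    "Tgt (span_shape e) (e 1) = e 1" "Tgt (span_shape e) (e 2) = e 2"
    "Tgt (span_shape e) (e 3) = e 1" "Tgt (span_shape e) (e 4) = e 2"
  by (simp_all add: span_shape_def inj_eq[OF assms])

lemma hom_span_shape:
  assumes "inj e"
  shows "t \<in> hom (span_shape e) x y \<longleftrightarrow>
    (t, x, y) \<in> {(e 0, e 0, e 0), (e 1, e 1, e 1), (e 2, e 2, e 2), (e 3, e 0, e 1), (e 4, e 0, e 2)}"
proof -
  have "t \<in> hom (span_shape e) x y \<longleftrightarrow>
    (\<exists>r\<in>Arr (span_shape e). t = r \<and> Src (span_shape e) r = x \<and> Tgt (span_shape e) r = y)"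
    unfolding hom_def by blast
  also have "\<dots> \<longleftrightarrow>
    (t, x, y) \<in> {(e 0, e 0, e 0), (e 1, e 1, e 1), (e 2, e 2, e 2), (e 3, e 0, e 1), (e 4, e 0, e 2)}"
    unfolding span_shape_simps(2)[OF assms] bex_simps span_shape_simps[OF assms] by blast
  finally show ?thesis .
qed

lemma category_span_shape:
  assumes "inj e"
  shows "category (span_shape e)"
proof
  note [simp] = inj_eq[OF assms]
  let ?J = "span_shape e"
  show "Src ?J f \<in> Obj ?J" "Tgt ?J f \<in> Obj ?J" if "f \<in> Arr ?J" for f
    using that by (auto simp: span_shape_def)
  show "Ident ?J a \<in> hom ?J a a" if "a \<in> Obj ?J" for a
    using that unfolding hom_span_shape[OF assms] by (auto simp: span_shape_def)
  show "g \<cdot>\<^bsub>?J\<^esub> f \<in> hom ?J a c" if "f \<in> hom ?J a b" "g \<in> hom ?J b c" for f g a b c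
    using that unfolding hom_span_shape[OF assms]
    by (auto simp: span_shape_def)
  show "f \<cdot>\<^bsub>?J\<^esub> Ident ?J a = f" "Ident ?J b \<cdot>\<^bsub>?J\<^esub> f = f" if "f \<in> hom ?J a b" for f a b
    using that unfolding hom_span_shape[OF assms] by (auto simp: span_shape_def)
  show "h \<cdot>\<^bsub>?J\<^esub> g \<cdot>\<^bsub>?J\<^esub> f = h \<cdot>\<^bsub>?J\<^esub> (g \<cdot>\<^bsub>?J\<^esub> f)" for f g h
    by (simp add: span_shape_def)
qed

lemma (in category) functor_from_span_shape:
  assumes e: "inj e" and f: "f \<in> hom C a b" and g: "g \<in> hom C a c"
  defines "FO \<equiv> \<lambda>x. if x = e 0 then a else if x = e 1 then b else c"
  defines "FM \<equiv> \<lambda>t. if t = e 3 then f else if t = e 4 then g else Ident C (FO t)"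
  shows "functor_between (span_shape e) C FO FM"
proof -
  interpret J: category "span_shape e" using e by (rule category_span_shape)
  have o: "a \<in> Obj C" "b \<in> Obj C" "c \<in> Obj C" using homD[OF f] homD[OF g] by auto
  note I = o[THEN Ident_in_hom]
  show ?thesis
  proof
    show "FO j \<in> Obj C" for j using o by (simp add: FO_def)
    show "FM t \<in> hom C (FO j) (FO k)" if "t \<in> hom (span_shape e) j k" for t j k
      using that f g I unfolding hom_span_shape[OF e]
      by (auto simp: FO_def FM_def inj_eq[OF e])
    show "FM (Ident (span_shape e) j) = Ident C (FO j)" if "j \<in> Obj (span_shape e)" for j
      using that by (auto simp: FM_def span_shape_def inj_eq[OF e])
    have FM_at: "FM (e 0) = Ident C a" "FM (e 1) = Ident C b" "FM (e 2) = Ident C c"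
      "FM (e 3) = f" "FM (e 4) = g"
      by (simp_all add: FO_def FM_def inj_eq[OF e])
    have composable: "\<forall>(t, r) \<in> {(e 0, e 0), (e 1, e 1), (e 2, e 2), (e 0, e 3), (e 0, e 4),
        (e 3, e 1), (e 4, e 2)}. FM (r \<cdot>\<^bsub>span_shape e\<^esub> t) = FM r \<cdot> FM t"
      by (simp add: span_shape_def inj_eq[OF e] FM_at I[THEN Comp_Ident]
          Comp_Ident[OF f] Comp_Ident[OF g] Ident_Comp[OF f] Ident_Comp[OF g] del: One_nat_def)
    show "FM (r \<cdot>\<^bsub>span_shape e\<^esub> t) = FM r \<cdot> FM t"
      if "t \<in> hom (span_shape e) j k" "r \<in> hom (span_shape e) k l" for t j k r l
    proof -
      have "(t, r) \<in> {(e 0, e 0), (e 1, e 1), (e 2, e 2), (e 0, e 3), (e 0, e 4),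
          (e 3, e 1), (e 4, e 2)}"
        using that unfolding hom_span_shape[OF e] by (auto simp: inj_eq[OF e])
      then show ?thesis using composable by blast
    qed
  qed
qed

text \<open>
  Infinity of the cardinal makes finite diagrams small, so that cocompleteness provides pushouts.
\<close>
locale infinitary_model_category = model_category +
  assumes Card_order: "Card_order \<kappa>" and cinfinite: "cinfinite \<kappa>"
begin

lemma pushout_exists:
  assumes f: "f \<in> hom M a b" and g: "g \<in> hom M a c"
  obtains p q d where "is_pushout M f g p q" "p \<in> hom M b d" "q \<in> hom M c d"
proof -
  have "infinite (UNIV :: 'a set)"
    using cinfinite unfolding cinfinite_def by (meson finite_subset subset_UNIV)
  then obtain e :: "nat \<Rightarrow> 'a" where e: "inj e"
    using infinite_countable_subset by blast
  define FO where "FO = (\<lambda>x. if x = e 0 then a else if x = e 1 then b else c)"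
  define FM where "FM = (\<lambda>t. if t = e 3 then f else if t = e 4 then g else Ident M (FO t))"
  have F: "functor_between (span_shape e) M FO FM"
    unfolding FM_def FO_def using e f g by (rule functor_from_span_shape)
  have "finite (Arr (span_shape e))" by (simp add: span_shape_def)
  moreover have "Well_order \<kappa>" "infinite (Field \<kappa>)"
    using Card_order cinfinite by (auto simp: card_order_on_def cinfinite_def)
  ultimately have "|Arr (span_shape e)| <o \<kappa>"
    by (metis finite_ordLess_infinite card_of_Well_order Field_card_of)
  then obtain d l where L: "is_colimit (span_shape e) M FO FM d l"
    using cocomplete F unfolding cocomplete_category_def by blast
  have cocone: "is_cocone (span_shape e) M FO FM y k \<longleftrightarrow>
      k (e 1) \<in> hom M b y \<and> k (e 2) \<in> hom M c y \<and>
      k (e 1) \<cdot> f = k (e 0) \<and> k (e 2) \<cdot> g = k (e 0)" for y k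
  proof -
    have F': "FO (e 0) = a" "FO (e 1) = b" "FO (e 2) = c" "FM (e 0) = Ident M a"
      "FM (e 1) = Ident M b" "FM (e 2) = Ident M c" "FM (e 3) = f" "FM (e 4) = g"
      by (simp_all add: FO_def FM_def inj_eq[OF e])
    have "is_cocone (span_shape e) M FO FM y k \<longleftrightarrow>
      y \<in> Obj M \<and> (k (e 0) \<in> hom M a y \<and> k (e 1) \<in> hom M b y \<and> k (e 2) \<in> hom M c y) \<and>
      k (e 0) \<cdot> Ident M a = k (e 0) \<and> k (e 1) \<cdot> Ident M b = k (e 1) \<and>
      k (e 2) \<cdot> Ident M c = k (e 2) \<and> k (e 1) \<cdot> f = k (e 0) \<and> k (e 2) \<cdot> g = k (e 0)"
      unfolding is_cocone_def span_shape_simps(1,2)[OF e] ball_simps span_shape_simps[OF e] F' by blast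
    also have "\<dots> \<longleftrightarrow> k (e 1) \<in> hom M b y \<and> k (e 2) \<in> hom M c y \<and>
      k (e 1) \<cdot> f = k (e 0) \<and> k (e 2) \<cdot> g = k (e 0)"
      using Comp_in_hom[OF f] Comp_Ident homD(5) by metis
    finally show ?thesis .
  qed
  define p q where "p = l (e 1)" and "q = l (e 2)"
  have pq: "p \<in> hom M b d" "q \<in> hom M c d" "p \<cdot> f = l (e 0)" "q \<cdot> g = l (e 0)"
    using L cocone[of d l] unfolding is_colimit_def p_def q_def by auto
  have "\<exists>!h. h \<in> hom M d y \<and> h \<cdot> p = x \<and> h \<cdot> q = z"
    if x: "x \<in> hom M b y" and z: "z \<in> hom M c y" and xz: "x \<cdot> f = z \<cdot> g" for x z y
  proof -
    define k where "k = (\<lambda>t. if t = e 0 then x \<cdot> f else if t = e 1 then x else z)"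
    have "is_cocone (span_shape e) M FO FM y k"
      unfolding cocone using x z xz by (auto simp: k_def inj_eq[OF e])
    then have ex: "\<exists>!h. h \<in> hom M d y \<and> (\<forall>j\<in>Obj (span_shape e). h \<cdot> l j = k j)"
      using L unfolding is_colimit_def by blast
    have "(\<forall>j\<in>Obj (span_shape e). h \<cdot> l j = k j) \<longleftrightarrow> h \<cdot> p = x \<and> h \<cdot> q = z"
      if h: "h \<in> hom M d y" for h
    proof -
      have "h \<cdot> l (e 0) = h \<cdot> p \<cdot> f" using Comp_assoc[OF f pq(1) h] pq(3) by simp
      then show ?thesis by (auto simp: k_def span_shape_def inj_eq[OF e] p_def q_def)
    qed
    then have "h \<in> hom M d y \<and> (\<forall>j\<in>Obj (span_shape e). h \<cdot> l j = k j) \<longleftrightarrow>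
      h \<in> hom M d y \<and> h \<cdot> p = x \<and> h \<cdot> q = z" for h by blast
    then show ?thesis using ex by simp
  qed
  then have "is_pushout M f g p q"
    using pq f g unfolding is_pushout_def by (auto simp: hom_def)
  then show thesis using that pq by blast
qed

end

section \<open>Trivial cofibrations and fibrant objects\<close>

context model_category
begin

lemma Cof_eq: "Cof M = llp M (Fib M \<inter> Weq M)"
  and TrivFib_eq: "Fib M \<inter> Weq M = rlp M (Cof M)"
  and TrivCof_eq: "Cof M \<inter> Weq M = llp M (Fib M)"
  and Fib_eq: "Fib M = rlp M (Cof M \<inter> Weq M)"
  using wfs_Cof wfs_Fib unfolding weak_factorization_system_def by blast+

lemma lift_Cof_TrivFib: "\<lbrakk>i \<in> Cof M; p \<in> Fib M; p \<in> Weq M\<rbrakk> \<Longrightarrow> has_lifting M i p"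
  using Cof_eq unfolding llp_def by blast

lemma lift_TrivCof_Fib: "\<lbrakk>i \<in> Cof M; i \<in> Weq M; p \<in> Fib M\<rbrakk> \<Longrightarrow> has_lifting M i p"
  using TrivCof_eq unfolding llp_def by blast

lemma FibD: "p \<in> Fib M \<Longrightarrow> p \<in> hom M (Src M p) (Tgt M p)"
  using Fib_eq unfolding rlp_def hom_def by blast

lemma CofD: "i \<in> Cof M \<Longrightarrow> i \<in> hom M (Src M i) (Tgt M i)"
  using Cof_eq unfolding llp_def hom_def by blast

lemma Ident_Weq:
  assumes "a \<in> Obj M"
  shows "Ident M a \<in> Weq M"
proof -
  have "Ident M a \<in> llp M (Fib M)"
    unfolding llp_def using assms Ident_in_hom[OF assms] FibD
    by (auto intro: has_lifting_Ident simp: homD(1))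
  then show ?thesis using TrivCof_eq by blast
qed

lemma Cof_Comp:
  assumes "i \<in> hom M a b" "j \<in> hom M b c" "i \<in> Cof M" "j \<in> Cof M"
  shows "j \<cdot> i \<in> Cof M"
proof -
  have "has_lifting M (j \<cdot> i) p" if "p \<in> Fib M" "p \<in> Weq M" for p
    using that assms FibD by (intro has_lifting_Comp_left[OF assms(1,2)] lift_Cof_TrivFib)
  then have "j \<cdot> i \<in> llp M (Fib M \<inter> Weq M)"
    unfolding llp_def using homD(1)[OF Comp_in_hom[OF assms(1,2)]] by auto
  then show ?thesis using Cof_eq by blast
qed

lemma Fib_Comp:
  assumes "p \<in> hom M a b" "q \<in> hom M b c" "p \<in> Fib M" "q \<in> Fib M"
  shows "q \<cdot> p \<in> Fib M"
proof -
  have "has_lifting M i (q \<cdot> p)" if "i \<in> Cof M" "i \<in> Weq M" for i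
    using that assms Weq_subset
    by (intro has_lifting_Comp_right[OF _ assms(1,2)] lift_TrivCof_Fib) (auto simp: hom_def)
  then have "q \<cdot> p \<in> rlp M (Cof M \<inter> Weq M)"
    unfolding rlp_def using homD(1)[OF Comp_in_hom[OF assms(1,2)]] by auto
  then show ?thesis using Fib_eq by blast
qed

lemma Cof_pushout:
  assumes "is_pushout M f g p q" "f \<in> hom M a b" "g \<in> hom M a c" "p \<in> hom M b d"
    and "g \<in> Cof M"
  shows "p \<in> Cof M"
proof -
  have "has_lifting M p t" if "t \<in> Fib M" "t \<in> Weq M" for t
    using that assms(5) FibD by (intro has_lifting_pushout[OF assms(1-4)] lift_Cof_TrivFib)
  then have "p \<in> llp M (Fib M \<inter> Weq M)"
    unfolding llp_def using homD(1)[OF assms(4)] by auto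
  then show ?thesis using Cof_eq by blast
qed

lemma TrivCof_pushout:
  assumes "is_pushout M f g p q" "f \<in> hom M a b" "g \<in> hom M a c" "p \<in> hom M b d"
    and "g \<in> Cof M" "g \<in> Weq M"
  shows "p \<in> Weq M"
proof -
  have "has_lifting M p t" if "t \<in> Fib M" for t
    using that assms(5,6) FibD by (intro has_lifting_pushout[OF assms(1-4)] lift_TrivCof_Fib)
  then have "p \<in> llp M (Fib M)"
    unfolding llp_def using homD(1)[OF assms(4)] by auto
  then show ?thesis using TrivCof_eq by blast
qed

lemma factor_Cof_TrivFib:
  assumes "f \<in> hom M a b"
  obtains j p z where "j \<in> hom M a z" "p \<in> hom M z b" "p \<cdot> j = f"
    "j \<in> Cof M" "p \<in> Fib M" "p \<in> Weq M"
proof -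
  obtain j p where jp: "j \<in> Cof M" "p \<in> Fib M \<inter> Weq M" "Tgt M j = Src M p" "f = p \<cdot> j"
    using wfs_Cof homD(1)[OF assms] unfolding weak_factorization_system_def by blast
  have j: "j \<in> hom M (Src M j) (Src M p)" and p: "p \<in> hom M (Src M p) (Tgt M p)"
    using jp CofD FibD by (auto simp: hom_def)
  have "Src M j = a" "Tgt M p = b" using Comp_in_hom[OF j p] jp(4) assms by (auto simp: hom_def)
  then show thesis using that[of j "Src M p" p] j p jp by auto
qed

lemma factor_TrivCof_Fib:
  assumes "f \<in> hom M a b"
  obtains j p z where "j \<in> hom M a z" "p \<in> hom M z b" "p \<cdot> j = f"
    "j \<in> Cof M" "j \<in> Weq M" "p \<in> Fib M"
proof -
  obtain j p where jp: "j \<in> Cof M \<inter> Weq M" "p \<in> Fib M" "Tgt M j = Src M p" "f = p \<cdot> j"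
    using wfs_Fib homD(1)[OF assms] unfolding weak_factorization_system_def by blast
  have j: "j \<in> hom M (Src M j) (Src M p)" and p: "p \<in> hom M (Src M p) (Tgt M p)"
    using jp CofD FibD by (auto simp: hom_def)
  have "Src M j = a" "Tgt M p = b" using Comp_in_hom[OF j p] jp(4) assms by (auto simp: hom_def)
  then show thesis using that[of j "Src M p" p] j p jp by auto
qed

lemma fibrant_over_terminal:
  assumes "fibrant M X"
  obtains t m where "is_terminal M t" "m \<in> hom M X t" "m \<in> Fib M"
  using assms unfolding fibrant_def by blast

lemma terminal_unique:
  assumes "is_terminal M t" "g \<in> hom M a t" "h \<in> hom M a t"
  shows "g = h"
  using assms homD(4)[OF assms(2)] unfolding is_terminal_def by blast

lemma fibrant_source:
  assumes p: "p \<in> hom M Z Y" "p \<in> Fib M" and Y: "fibrant M Y"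
  shows "fibrant M Z"
proof -
  obtain t m where m: "is_terminal M t" "m \<in> hom M Y t" "m \<in> Fib M"
    using fibrant_over_terminal[OF Y] .
  show ?thesis
    unfolding fibrant_def
    using m(1) Comp_in_hom[OF p(1) m(2)] Fib_Comp[OF p(1) m(2) p(2) m(3)] by blast
qed

lemma extend_to_fibrant:
  assumes i: "i \<in> hom M a b" "i \<in> Cof M" "i \<in> Weq M" and X: "fibrant M X" and u: "u \<in> hom M a X"
  obtains h where "h \<in> hom M b X" "h \<cdot> i = u"
proof -
  obtain t m where m: "is_terminal M t" "m \<in> hom M X t" "m \<in> Fib M"
    using fibrant_over_terminal[OF X] .
  obtain n where n: "n \<in> hom M b t" using m(1) homD(5)[OF i(1)] unfolding is_terminal_def by blast
  have "m \<cdot> u = n \<cdot> i"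
    using terminal_unique[OF m(1) Comp_in_hom[OF u m(2)] Comp_in_hom[OF i(1) n]] .
  then show thesis
    using lift_in_square[OF lift_TrivCof_Fib[OF i(2,3) m(3)] i(1) m(2) u n] that by metis
qed

end

section \<open>Relative homotopy\<close>

context model_category
begin

lemma rel_cylinderE:
  assumes i: "i \<in> hom M U V" and K: "is_rel_cylinder M i K"
  obtains p q c P where "is_pushout M i i p q" "p \<in> hom M V P" "q \<in> hom M V P"
    "c \<in> hom M P (Tgt M (cyl_in0 K))" "c \<in> Cof M" "cyl_in0 K = c \<cdot> p" "cyl_in1 K = c \<cdot> q"
    "cyl_proj K \<in> hom M (Tgt M (cyl_in0 K)) V" "cyl_proj K \<in> Fib M" "cyl_proj K \<in> Weq M"
    "cyl_proj K \<cdot> cyl_in0 K = Ident M V" "cyl_proj K \<cdot> cyl_in1 K = Ident M V"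
proof -
  obtain p q c where *: "is_pushout M i i p q" "c \<in> Cof M" "Src M c = Tgt M p"
    "c \<cdot> p = cyl_in0 K" "c \<cdot> q = cyl_in1 K"
    "cyl_proj K \<in> Fib M \<inter> Weq M" "cyl_proj K \<in> hom M (Tgt M c) (Tgt M i)"
    "(cyl_proj K \<cdot> c) \<cdot> p = Ident M (Tgt M i)" "(cyl_proj K \<cdot> c) \<cdot> q = Ident M (Tgt M i)"
    using K unfolding is_rel_cylinder_def by blast
  have V: "Tgt M i = V" using homD(3)[OF i] .
  have p: "p \<in> hom M V (Tgt M p)" and q: "q \<in> hom M V (Tgt M p)"
    using pushoutD[OF *(1) i i] by auto
  have c: "c \<in> hom M (Tgt M p) (Tgt M c)" using CofD[OF *(2)] *(3) by simp
  have D: "Tgt M c = Tgt M (cyl_in0 K)" using homD(3)[OF Comp_in_hom[OF p c]] *(4) by simp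
  have s: "cyl_proj K \<in> hom M (Tgt M c) V" using *(7) V by simp
  have e: "cyl_proj K \<cdot> cyl_in0 K = Ident M V" "cyl_proj K \<cdot> cyl_in1 K = Ident M V"
    using Comp_assoc[OF p c s] Comp_assoc[OF q c s] *(4,5,8,9) V by auto
  show thesis
    using *(6) that[OF *(1) p q c[unfolded D] *(2) *(4,5)[symmetric] s[unfolded D] _ _ e] by blast
qed

lemma rel_cylinder_ends:
  assumes i: "i \<in> hom M U V" and K: "is_rel_cylinder M i K"
  shows "cyl_in0 K \<in> hom M V (Tgt M (cyl_in0 K))" "cyl_in1 K \<in> hom M V (Tgt M (cyl_in0 K))"
    "cyl_in0 K \<cdot> i = cyl_in1 K \<cdot> i"
    "cyl_proj K \<in> hom M (Tgt M (cyl_in0 K)) V" "cyl_proj K \<in> Fib M" "cyl_proj K \<in> Weq M"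
    "cyl_proj K \<cdot> cyl_in0 K = Ident M V" "cyl_proj K \<cdot> cyl_in1 K = Ident M V"
proof -
  obtain p q c P where *: "is_pushout M i i p q" "p \<in> hom M V P" "q \<in> hom M V P"
    "c \<in> hom M P (Tgt M (cyl_in0 K))" "c \<in> Cof M" "cyl_in0 K = c \<cdot> p" "cyl_in1 K = c \<cdot> q"
    and s: "cyl_proj K \<in> hom M (Tgt M (cyl_in0 K)) V" "cyl_proj K \<in> Fib M" "cyl_proj K \<in> Weq M"
    "cyl_proj K \<cdot> cyl_in0 K = Ident M V" "cyl_proj K \<cdot> cyl_in1 K = Ident M V"
    using rel_cylinderE[OF i K] .
  show "cyl_in0 K \<in> hom M V (Tgt M (cyl_in0 K))" "cyl_in1 K \<in> hom M V (Tgt M (cyl_in0 K))"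
    using Comp_in_hom[OF *(2,4)] Comp_in_hom[OF *(3,4)] *(6,7) by metis+
  show "cyl_in0 K \<cdot> i = cyl_in1 K \<cdot> i"
    using Comp_assoc[OF i *(2,4)] Comp_assoc[OF i *(3,4)] pushoutD(3)[OF *(1) i i] *(6,7) by metis
  show "cyl_proj K \<in> hom M (Tgt M (cyl_in0 K)) V" "cyl_proj K \<in> Fib M" "cyl_proj K \<in> Weq M"
    "cyl_proj K \<cdot> cyl_in0 K = Ident M V" "cyl_proj K \<cdot> cyl_in1 K = Ident M V"
    by (fact s)+
qed

lemma Weq_section:
  assumes "e \<in> hom M a b" "s \<in> hom M b a" "s \<cdot> e = Ident M a" "s \<in> Weq M"
  shows "e \<in> Weq M"
  using assms Weq_cancel_left Ident_Weq homD(4)[OF assms(1)] by metis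

lemma Weq_retraction:
  assumes "e \<in> hom M a b" "s \<in> hom M b a" "s \<cdot> e = Ident M a" "e \<in> Weq M"
  shows "s \<in> Weq M"
  using assms Weq_cancel_right Ident_Weq homD(4)[OF assms(1)] by metis

text \<open>
  Each map \<open>V \<rightarrow> V \<amalg>\<^sub>U V\<close> is a pushout of \<open>i\<close>, which makes the ends cofibrations; as sections of
  the projection they are weak equivalences.
\<close>
lemma rel_cylinder_ends_TrivCof:
  assumes i: "i \<in> hom M U V" "i \<in> Cof M" and K: "is_rel_cylinder M i K"
  shows "cyl_in0 K \<in> Cof M" "cyl_in0 K \<in> Weq M" "cyl_in1 K \<in> Cof M" "cyl_in1 K \<in> Weq M"
proof -
  obtain p q c P where *: "is_pushout M i i p q" "p \<in> hom M V P" "q \<in> hom M V P"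
    "c \<in> hom M P (Tgt M (cyl_in0 K))" "c \<in> Cof M" "cyl_in0 K = c \<cdot> p" "cyl_in1 K = c \<cdot> q"
    using rel_cylinderE[OF i(1) K] .
  note e = rel_cylinder_ends[OF i(1) K]
  have "p \<in> Cof M" "q \<in> Cof M"
    using Cof_pushout[OF *(1) i(1) i(1) *(2) i(2)]
      Cof_pushout[OF pushout_sym[OF *(1)] i(1) i(1) *(3) i(2)] .
  then show "cyl_in0 K \<in> Cof M" "cyl_in1 K \<in> Cof M"
    using Cof_Comp[OF *(2,4)] Cof_Comp[OF *(3,4)] *(5,6,7) by auto
  show "cyl_in0 K \<in> Weq M" "cyl_in1 K \<in> Weq M"
    using Weq_section[OF e(1,4,7,6)] Weq_section[OF e(2,4,8,6)] .
qed

lemma rel_homotopicI: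
  assumes "a \<in> hom M V Y" "h \<in> hom M (Tgt M (cyl_in0 (cyl i))) Y"
    "h \<cdot> cyl_in0 (cyl i) = a" "h \<cdot> cyl_in1 (cyl i) = b"
  shows "rel_homotopic M cyl i a b"
  unfolding rel_homotopic_def homD(3)[OF assms(1)] using assms(2-4) by blast

lemma rel_homotopicE:
  assumes "rel_homotopic M cyl i a b" "a \<in> hom M V Y"
  obtains h where "h \<in> hom M (Tgt M (cyl_in0 (cyl i))) Y"
    "h \<cdot> cyl_in0 (cyl i) = a" "h \<cdot> cyl_in1 (cyl i) = b"
  using assms(1)[unfolded rel_homotopic_def homD(3)[OF assms(2)]] that by blast

lemma rel_homotopic_Comp_left:
  assumes i: "i \<in> hom M U V" and K: "is_rel_cylinder M i (cyl i)"
    and a: "a \<in> hom M V Y" and t: "t \<in> hom M Y Z" and ab: "rel_homotopic M cyl i a b"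
  shows "rel_homotopic M cyl i (t \<cdot> a) (t \<cdot> b)"
proof -
  note D = rel_cylinder_ends[OF i K]
  obtain h where h: "h \<in> hom M (Tgt M (cyl_in0 (cyl i))) Y"
    "h \<cdot> cyl_in0 (cyl i) = a" "h \<cdot> cyl_in1 (cyl i) = b"
    using rel_homotopicE[OF ab a] .
  have "(t \<cdot> h) \<cdot> cyl_in0 (cyl i) = t \<cdot> a" "(t \<cdot> h) \<cdot> cyl_in1 (cyl i) = t \<cdot> b"
    unfolding Comp_assoc[OF D(1) h(1) t] Comp_assoc[OF D(2) h(1) t] h(2,3) by (rule refl)+
  with Comp_in_hom[OF a t] Comp_in_hom[OF h(1) t] show ?thesis by (rule rel_homotopicI)
qed

text \<open>
  A map of squares induces a map of cylinders \<open>C\<^sub>U(V) \<rightarrow> C\<^sub>X(Z)\<close> compatible with the ends: it is a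
  lift of the cofibration \<open>V \<amalg>\<^sub>U V \<rightarrow> C\<^sub>U(V)\<close> against the trivial fibration \<open>C\<^sub>X(Z) \<rightarrow> Z\<close>.
\<close>
lemma rel_homotopic_Comp_right:
  assumes i: "i \<in> hom M U V" and Ki: "is_rel_cylinder M i (cyl i)"
    and j: "j \<in> hom M X Z" and Kj: "is_rel_cylinder M j (cyl j)"
    and x: "x \<in> hom M U X" and k: "k \<in> hom M V Z" and sq: "k \<cdot> i = j \<cdot> x"
    and a: "a \<in> hom M Z Y" and ab: "rel_homotopic M cyl j a b"
  shows "rel_homotopic M cyl i (a \<cdot> k) (b \<cdot> k)"
proof -
  define D where "D = Tgt M (cyl_in0 (cyl i))"
  define t where "t = cyl_proj (cyl i)"
  obtain p q c P where i': "is_pushout M i i p q" "p \<in> hom M V P" "q \<in> hom M V P"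
    "c \<in> hom M P D" "c \<in> Cof M" "cyl_in0 (cyl i) = c \<cdot> p" "cyl_in1 (cyl i) = c \<cdot> q"
    unfolding D_def using rel_cylinderE[OF i Ki] .
  note d = rel_cylinder_ends[OF i Ki, folded D_def t_def]
  define e0 e1 s D' where "e0 = cyl_in0 (cyl j)" and "e1 = cyl_in1 (cyl j)"
    and "s = cyl_proj (cyl j)" and "D' = Tgt M (cyl_in0 (cyl j))"
  note j' = rel_cylinder_ends[OF j Kj, folded D'_def, folded e0_def e1_def s_def]
  obtain h where h: "h \<in> hom M D' Y" "h \<cdot> e0 = a" "h \<cdot> e1 = b"
    unfolding e0_def e1_def D'_def using rel_homotopicE[OF ab a] .
  have k0: "e0 \<cdot> k \<in> hom M V D'" and k1: "e1 \<cdot> k \<in> hom M V D'"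
    using Comp_in_hom[OF k j'(1)] Comp_in_hom[OF k j'(2)] .
  have "(e0 \<cdot> k) \<cdot> i = (e1 \<cdot> k) \<cdot> i"
    using Comp_assoc[OF i k j'(1)] Comp_assoc[OF i k j'(2)] Comp_assoc[OF x j j'(1)]
      Comp_assoc[OF x j j'(2)] sq j'(3) by metis
  then obtain g where g: "g \<in> hom M P D'" "g \<cdot> p = e0 \<cdot> k" "g \<cdot> q = e1 \<cdot> k"
    using pushout_desc[OF i'(1) i i i'(2) k0 k1] by blast
  have kt: "k \<cdot> t \<in> hom M D Z" using Comp_in_hom[OF d(4) k] .
  have "s \<cdot> g = k \<cdot> t \<cdot> c"
  proof (rule pushout_ext[OF i'(1) i i i'(2) Comp_in_hom[OF g(1) j'(4)] Comp_in_hom[OF i'(4) kt]])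
    have "s \<cdot> g \<cdot> p = k"
      using Comp_assoc[OF i'(2) g(1) j'(4)] Comp_assoc[OF k j'(1,4)] Ident_Comp[OF k] g(2) j'(7)
      by metis
    moreover have "k \<cdot> t \<cdot> c \<cdot> p = k"
      using Comp_assoc[OF i'(2,4) kt] Comp_assoc[OF d(1,4) k] Comp_Ident[OF k] d(7) i'(6)
      by metis
    ultimately show "s \<cdot> g \<cdot> p = k \<cdot> t \<cdot> c \<cdot> p" by simp
    have "s \<cdot> g \<cdot> q = k"
      using Comp_assoc[OF i'(3) g(1) j'(4)] Comp_assoc[OF k j'(2,4)] Ident_Comp[OF k] g(3) j'(8)
      by metis
    moreover have "k \<cdot> t \<cdot> c \<cdot> q = k"
      using Comp_assoc[OF i'(3,4) kt] Comp_assoc[OF d(2,4) k] Comp_Ident[OF k] d(8) i'(7)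
      by metis
    ultimately show "s \<cdot> g \<cdot> q = k \<cdot> t \<cdot> c \<cdot> q" by simp
  qed
  then obtain l where l: "l \<in> hom M D D'" "l \<cdot> c = g"
    using lift_in_square[OF lift_Cof_TrivFib[OF i'(5) j'(5,6)] i'(4) j'(4) g(1) kt] by blast
  have l0: "l \<cdot> cyl_in0 (cyl i) = e0 \<cdot> k" and l1: "l \<cdot> cyl_in1 (cyl i) = e1 \<cdot> k"
    using Comp_assoc[OF i'(2,4) l(1)] Comp_assoc[OF i'(3,4) l(1)] l(2) g i'(6,7) by auto
  have "(h \<cdot> l) \<cdot> cyl_in0 (cyl i) = a \<cdot> k" "(h \<cdot> l) \<cdot> cyl_in1 (cyl i) = b \<cdot> k"
    using Comp_assoc[OF d(1) l(1) h(1)] Comp_assoc[OF d(2) l(1) h(1)] l0 l1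
      Comp_assoc[OF k j'(1) h(1)] Comp_assoc[OF k j'(2) h(1)] h(2,3) by auto
  with Comp_in_hom[OF k a] Comp_in_hom[OF l(1) h(1), unfolded D_def]
  show ?thesis by (rule rel_homotopicI)
qed

text \<open>
  The retraction extends \<open>id\<^sub>X\<close> along \<open>j\<close>. For the homotopy, \<open>Z \<rightarrow> Z \<amalg>\<^sub>X Z\<close> is a trivial
  cofibration as a pushout of \<open>j\<close>, so by 2-out-of-3 \<open>Z \<amalg>\<^sub>X Z \<rightarrow> C\<^sub>X(Z)\<close> is one too, and
  \<open>[j r, id]\<close> extends to the cylinder since \<open>Z\<close> is fibrant.
\<close>
lemma TrivCof_deformation_retract:
  assumes j: "j \<in> hom M X Z" "j \<in> Cof M" "j \<in> Weq M"
    and X: "fibrant M X" and Z: "fibrant M Z" and K: "is_rel_cylinder M j (cyl j)"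
  obtains r where "r \<in> hom M Z X" "r \<cdot> j = Ident M X" "rel_homotopic M cyl j (j \<cdot> r) (Ident M Z)"
proof -
  have IX: "Ident M X \<in> hom M X X" and IZ: "Ident M Z \<in> hom M Z Z"
    using Ident_in_hom homD[OF j(1)] by auto
  obtain r where r: "r \<in> hom M Z X" "r \<cdot> j = Ident M X"
    using extend_to_fibrant[OF j X IX] .
  define D where "D = Tgt M (cyl_in0 (cyl j))"
  obtain p q c P where K': "is_pushout M j j p q" "p \<in> hom M Z P" "q \<in> hom M Z P"
    "c \<in> hom M P D" "c \<in> Cof M" "cyl_in0 (cyl j) = c \<cdot> p" "cyl_in1 (cyl j) = c \<cdot> q"
    unfolding D_def using rel_cylinderE[OF j(1) K] .
  have "p \<in> Weq M" using TrivCof_pushout[OF K'(1) j(1) j(1) K'(2) j(2,3)] .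
  moreover have "c \<cdot> p \<in> Weq M" using rel_cylinder_ends_TrivCof(2)[OF j(1,2) K] K'(6) by simp
  ultimately have c: "c \<in> Weq M" using Weq_cancel_right[OF K'(2,4)] by blast
  have jr: "j \<cdot> r \<in> hom M Z Z" using Comp_in_hom[OF r(1) j(1)] .
  have "(j \<cdot> r) \<cdot> j = Ident M Z \<cdot> j"
    using Comp_assoc[OF j(1) r(1) j(1)] r(2) Comp_Ident[OF j(1)] Ident_Comp[OF j(1)] by metis
  then obtain g where g: "g \<in> hom M P Z" "g \<cdot> p = j \<cdot> r" "g \<cdot> q = Ident M Z"
    using pushout_desc[OF K'(1) j(1) j(1) K'(2) jr IZ] by blast
  obtain h where h: "h \<in> hom M D Z" "h \<cdot> c = g"
    using extend_to_fibrant[OF K'(4,5) c Z g(1)] .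
  have "h \<cdot> cyl_in0 (cyl j) = j \<cdot> r" "h \<cdot> cyl_in1 (cyl j) = Ident M Z"
    using h(2) g Comp_assoc[OF K'(2,4) h(1)] Comp_assoc[OF K'(3,4) h(1)] K'(6,7) by auto
  with jr h(1)[unfolded D_def] have "rel_homotopic M cyl j (j \<cdot> r) (Ident M Z)"
    by (rule rel_homotopicI)
  then show thesis using that r by blast
qed

lemma Weq_has_rlp_upto_homotopy:
  assumes cyl: "rel_cylinder_choice M cyl"
    and f: "f \<in> hom M X Y" "f \<in> Weq M" and X: "fibrant M X" and Y: "fibrant M Y"
    and i: "i \<in> Cof M"
  shows "has_rlp_upto_homotopy M cyl f i"
proof -
  obtain j p Z where jp: "j \<in> hom M X Z" "p \<in> hom M Z Y" "p \<cdot> j = f"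
    "j \<in> Cof M" "p \<in> Fib M" "p \<in> Weq M"
    using factor_Cof_TrivFib[OF f(1)] .
  have jW: "j \<in> Weq M" using Weq_cancel_left[OF jp(1,2,6)] jp(3) f(2) by simp
  have Kj: "is_rel_cylinder M j (cyl j)"
    using cyl homD(1)[OF jp(1)] unfolding rel_cylinder_choice_def by blast
  obtain r where r: "r \<in> hom M Z X" "r \<cdot> j = Ident M X"
    "rel_homotopic M cyl j (j \<cdot> r) (Ident M Z)"
    using TrivCof_deformation_retract[where cyl = cyl, OF jp(1,4) jW X fibrant_source[OF jp(2,5) Y] Kj] .
  obtain U V where i': "i \<in> hom M U V" using CofD[OF i] by blast
  have Ki: "is_rel_cylinder M i (cyl i)"
    using cyl homD(1)[OF i'] unfolding rel_cylinder_choice_def by blast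
  have jr: "j \<cdot> r \<in> hom M Z Z" using Comp_in_hom[OF r(1) jp(1)] .
  show ?thesis
    unfolding has_rlp_upto_homotopy_def homD(2,3)[OF i'] homD(2,3)[OF f(1)]
  proof (intro ballI impI)
    fix u v assume u: "u \<in> hom M U X" and v: "v \<in> hom M V Y" and e: "f \<cdot> u = v \<cdot> i"
    have "p \<cdot> (j \<cdot> u) = v \<cdot> i" using Comp_assoc[OF u jp(1,2)] jp(3) e by metis
    then obtain k where k: "k \<in> hom M V Z" "k \<cdot> i = j \<cdot> u" "p \<cdot> k = v"
      using lift_in_square[OF lift_Cof_TrivFib[OF i jp(5,6)] i' jp(2) Comp_in_hom[OF u jp(1)] v]
      by blast
    have rk: "r \<cdot> k \<in> hom M V X" using Comp_in_hom[OF k(1) r(1)] .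
    have "(r \<cdot> k) \<cdot> i = u"
      using Comp_assoc[OF i' k(1) r(1)] k(2) Comp_assoc[OF u jp(1) r(1)] r(2) Ident_Comp[OF u]
      by metis
    moreover have "rel_homotopic M cyl i ((j \<cdot> r) \<cdot> k) (Ident M Z \<cdot> k)"
      using rel_homotopic_Comp_right[where cyl = cyl, OF i' Ki jp(1) Kj u k(1,2) jr r(3)] .
    then have "rel_homotopic M cyl i (p \<cdot> ((j \<cdot> r) \<cdot> k)) (p \<cdot> (Ident M Z \<cdot> k))"
      by (rule rel_homotopic_Comp_left[where cyl = cyl, OF i' Ki Comp_in_hom[OF k(1) jr] jp(2)])
    then have "rel_homotopic M cyl i (f \<cdot> (r \<cdot> k)) v"
      using Comp_assoc[OF k(1) r(1) jp(1)] Comp_assoc[OF rk jp(1,2)] jp(3) k(3) Ident_Comp[OF k(1)]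
      by metis
    ultimately show "\<exists>k\<in>hom M V X. k \<cdot> i = u \<and> rel_homotopic M cyl i (f \<cdot> k) v"
      using rk by blast
  qed
qed

text \<open>
  This and the next lemma translate lifting along a trivial cofibration out of a pushout into
  statements about the two legs, which is how homotopy lifting and extension are used on
  \<open>C\<^sub>X(Z) \<amalg>\<^sub>Z W \<rightarrow> E\<close>.
\<close>
lemma lift_from_pushout:
  assumes P: "is_pushout M f g x y" and f: "f \<in> hom M A B" and g: "g \<in> hom M A C"
    and x: "x \<in> hom M B D" and d: "d \<in> hom M D E" "d \<in> Cof M" "d \<in> Weq M"
    and p: "p \<in> hom M S T" "p \<in> Fib M"
    and a: "a \<in> hom M B S" and b: "b \<in> hom M C S" and ab: "a \<cdot> f = b \<cdot> g"
    and H: "H \<in> hom M E T" "H \<cdot> (d \<cdot> x) = p \<cdot> a" "H \<cdot> (d \<cdot> y) = p \<cdot> b"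
  obtains L where "L \<in> hom M E S" "L \<cdot> (d \<cdot> x) = a" "L \<cdot> (d \<cdot> y) = b" "p \<cdot> L = H"
proof -
  have y: "y \<in> hom M C D" using pushoutD(2)[OF P f g] homD(3)[OF x] by simp
  obtain h where h: "h \<in> hom M D S" "h \<cdot> x = a" "h \<cdot> y = b"
    using pushout_desc[OF P f g x a b ab] .
  have "p \<cdot> h = H \<cdot> d"
    by (rule pushout_ext[OF P f g x Comp_in_hom[OF h(1) p(1)] Comp_in_hom[OF d(1) H(1)]])
      (simp_all add: Comp_assoc[OF x h(1) p(1)] Comp_assoc[OF y h(1) p(1)]
        Comp_assoc[OF x d(1) H(1)] Comp_assoc[OF y d(1) H(1)] h H)
  then obtain L where L: "L \<in> hom M E S" "L \<cdot> d = h" "p \<cdot> L = H"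
    using lift_in_square[OF lift_TrivCof_Fib[OF d(2,3) p(2)] d(1) p(1) h(1) H(1)] by blast
  then show thesis
    using that[OF L(1)] h Comp_assoc[OF x d(1) L(1)] Comp_assoc[OF y d(1) L(1)] by metis
qed

lemma extend_from_pushout:
  assumes P: "is_pushout M f g x y" and f: "f \<in> hom M A B" and g: "g \<in> hom M A C"
    and x: "x \<in> hom M B D" and d: "d \<in> hom M D E" "d \<in> Cof M" "d \<in> Weq M"
    and S: "fibrant M S"
    and a: "a \<in> hom M B S" and b: "b \<in> hom M C S" and ab: "a \<cdot> f = b \<cdot> g"
  obtains L where "L \<in> hom M E S" "L \<cdot> (d \<cdot> x) = a" "L \<cdot> (d \<cdot> y) = b"
proof -
  have y: "y \<in> hom M C D" using pushoutD(2)[OF P f g] homD(3)[OF x] by simp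
  obtain h where h: "h \<in> hom M D S" "h \<cdot> x = a" "h \<cdot> y = b"
    using pushout_desc[OF P f g x a b ab] .
  obtain L where L: "L \<in> hom M E S" "L \<cdot> d = h"
    using extend_to_fibrant[OF d S h(1)] .
  then show thesis
    using that[OF L(1)] h Comp_assoc[OF x d(1) L(1)] Comp_assoc[OF y d(1) L(1)] by metis
qed

end

section \<open>Detecting weak equivalences\<close>

context infinitary_model_category
begin

text \<open>
  Here \<open>A = C \<amalg>\<^sub>Z W\<close> is the cylinder with \<open>W\<close> attached at one end. Collapsing the cylinder
  retracts \<open>A\<close> onto \<open>W\<close>; the inclusion of \<open>W\<close> is a pushout of the trivial cofibration \<open>e\<close>, so
  the collapse \<open>t\<close> is a weak equivalence.
\<close>
lemma pushout_along_section:
  assumes e: "e \<in> hom M Z C" "e \<in> Cof M" "e \<in> Weq M"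
    and s: "s \<in> hom M C Z" "s \<cdot> e = Ident M Z"
    and w: "w \<in> hom M Z W" "w \<in> Cof M"
  obtains A a b t where "is_pushout M e w a b" "a \<in> hom M C A" "b \<in> hom M W A" "a \<in> Cof M"
    "t \<in> hom M A W" "t \<in> Weq M" "t \<cdot> a = w \<cdot> s" "t \<cdot> b = Ident M W"
proof -
  obtain a b A where P: "is_pushout M e w a b" "a \<in> hom M C A" "b \<in> hom M W A"
    using pushout_exists[OF e(1) w(1)] .
  have I: "Ident M W \<in> hom M W W" using Ident_in_hom homD(5)[OF w(1)] by blast
  have "(w \<cdot> s) \<cdot> e = Ident M W \<cdot> w"
    using Comp_assoc[OF e(1) s(1) w(1)] s(2) Comp_Ident[OF w(1)] Ident_Comp[OF w(1)] by metis
  then obtain t where t: "t \<in> hom M A W" "t \<cdot> a = w \<cdot> s" "t \<cdot> b = Ident M W"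
    using pushout_desc[OF P(1) e(1) w(1) P(2) Comp_in_hom[OF s(1) w(1)] I] by blast
  have "b \<in> Weq M" using TrivCof_pushout[OF pushout_sym[OF P(1)] w(1) e(1) P(3) e(2,3)] .
  then have "t \<in> Weq M" using Weq_retraction[OF P(3) t(1,3)] by blast
  then show thesis using that[OF P Cof_pushout[OF P(1) e(1) w(1) P(2) w(2)]] t by blast
qed

text \<open>
  The object \<open>E\<close> is a cylinder on \<open>W\<close> extending a given cylinder on \<open>Z\<close>. It is obtained by
  attaching \<open>W\<close> at both ends, which gives \<open>Q\<close>, and factoring the collapse \<open>Q \<rightarrow> W\<close> as a
  cofibration followed by a trivial fibration. Either inclusion \<open>A\<^sub>0, A\<^sub>1 \<rightarrow> Q \<rightarrow> E\<close> is a cofibration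
  because the other copy of \<open>W\<close> is attached along one, and a weak equivalence because \<open>A\<^sub>0\<close>,
  \<open>A\<^sub>1\<close> and \<open>E\<close> all collapse to \<open>W\<close> by weak equivalences.
\<close>
lemma glued_cylinder:
  assumes e0: "e0 \<in> hom M Z C" "e0 \<in> Cof M" "e0 \<in> Weq M"
    and e1: "e1 \<in> hom M Z C" "e1 \<in> Cof M" "e1 \<in> Weq M"
    and s: "s \<in> hom M C Z" "s \<cdot> e0 = Ident M Z" "s \<cdot> e1 = Ident M Z"
    and w: "w \<in> hom M Z W" "w \<in> Cof M"
  obtains E A0 a0 b0 d0 A1 a1 b1 d1 where
    "is_pushout M e0 w a0 b0" "a0 \<in> hom M C A0" "b0 \<in> hom M W A0"
    "d0 \<in> hom M A0 E" "d0 \<in> Cof M" "d0 \<in> Weq M"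
    "is_pushout M e1 w a1 b1" "a1 \<in> hom M C A1" "b1 \<in> hom M W A1"
    "d1 \<in> hom M A1 E" "d1 \<in> Cof M" "d1 \<in> Weq M"
    "d0 \<cdot> a0 = d1 \<cdot> a1"
proof -
  obtain A0 a0 b0 t0 where 0: "is_pushout M e0 w a0 b0" "a0 \<in> hom M C A0" "b0 \<in> hom M W A0"
    "a0 \<in> Cof M" "t0 \<in> hom M A0 W" "t0 \<in> Weq M" "t0 \<cdot> a0 = w \<cdot> s" "t0 \<cdot> b0 = Ident M W"
    using pushout_along_section[OF e0 s(1,2) w] .
  obtain A1 a1 b1 t1 where 1: "is_pushout M e1 w a1 b1" "a1 \<in> hom M C A1" "b1 \<in> hom M W A1"
    "a1 \<in> Cof M" "t1 \<in> hom M A1 W" "t1 \<in> Weq M" "t1 \<cdot> a1 = w \<cdot> s" "t1 \<cdot> b1 = Ident M W"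
    using pushout_along_section[OF e1 s(1,3) w] .
  obtain q0 q1 Q where Q: "is_pushout M a0 a1 q0 q1" "q0 \<in> hom M A0 Q" "q1 \<in> hom M A1 Q"
    using pushout_exists[OF 0(2) 1(2)] .
  have qC: "q0 \<in> Cof M" "q1 \<in> Cof M"
    using Cof_pushout[OF Q(1) 0(2) 1(2) Q(2) 1(4)]
      Cof_pushout[OF pushout_sym[OF Q(1)] 1(2) 0(2) Q(3) 0(4)] .
  have "t0 \<cdot> a0 = t1 \<cdot> a1" using 0(7) 1(7) by simp
  then obtain t where t: "t \<in> hom M Q W" "t \<cdot> q0 = t0" "t \<cdot> q1 = t1"
    using pushout_desc[OF Q(1) 0(2) 1(2) Q(2) 0(5) 1(5)] by blast
  obtain c z E where c: "c \<in> hom M Q E" "z \<in> hom M E W" "z \<cdot> c = t"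
    "c \<in> Cof M" "z \<in> Fib M" "z \<in> Weq M"
    using factor_Cof_TrivFib[OF t(1)] .
  have d: "c \<cdot> q0 \<in> hom M A0 E" "c \<cdot> q1 \<in> hom M A1 E"
    using Comp_in_hom[OF Q(2) c(1)] Comp_in_hom[OF Q(3) c(1)] .
  have dC: "c \<cdot> q0 \<in> Cof M" "c \<cdot> q1 \<in> Cof M"
    using Cof_Comp[OF Q(2) c(1) qC(1) c(4)] Cof_Comp[OF Q(3) c(1) qC(2) c(4)] .
  have "z \<cdot> (c \<cdot> q0) \<in> Weq M" "z \<cdot> (c \<cdot> q1) \<in> Weq M"
    using Comp_assoc[OF Q(2) c(1,2)] Comp_assoc[OF Q(3) c(1,2)] c(3) t(2,3) 0(6) 1(6) by auto
  then have dW: "c \<cdot> q0 \<in> Weq M" "c \<cdot> q1 \<in> Weq M"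
    using Weq_cancel_left[OF d(1) c(2,6)] Weq_cancel_left[OF d(2) c(2,6)] by auto
  have "(c \<cdot> q0) \<cdot> a0 = (c \<cdot> q1) \<cdot> a1"
    using Comp_assoc[OF 0(2) Q(2) c(1)] Comp_assoc[OF 1(2) Q(3) c(1)] pushoutD(3)[OF Q(1) 0(2) 1(2)]
    by metis
  then show thesis
    using that[OF 0(1-3) d(1) dC(1) dW(1) 1(1-3) d(2) dC(2) dW(2)] by blast
qed

text \<open>
  The heart of the matter: for the fibration \<open>p\<close>, lifting up to homotopy against \<open>p j\<close> can be
  rectified to strict lifting. The retraction \<open>r\<close> moves the lifting problem to \<open>X\<close>, where the
  hypothesis applies, at the price of two homotopies, and both of them lift along \<open>p\<close>.
\<close>
lemma homotopy_lift_imp_lift: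
  assumes cyl: "rel_cylinder_choice M cyl"
    and j: "j \<in> hom M X Z" "j \<in> Cof M" "j \<in> Weq M" and p: "p \<in> hom M Z Y" "p \<in> Fib M"
    and X: "fibrant M X" and Y: "fibrant M Y"
    and i: "i \<in> Cof M" and lift: "has_rlp_upto_homotopy M cyl (p \<cdot> j) i"
  shows "has_lifting M i p"
proof -
  obtain U V where i': "i \<in> hom M U V" using CofD[OF i] by blast
  have Ki: "is_rel_cylinder M i (cyl i)" and Kj: "is_rel_cylinder M j (cyl j)"
    using cyl homD(1)[OF i'] homD(1)[OF j(1)] unfolding rel_cylinder_choice_def by auto
  obtain r where r: "r \<in> hom M Z X" "r \<cdot> j = Ident M X"
    "rel_homotopic M cyl j (j \<cdot> r) (Ident M Z)"
    using TrivCof_deformation_retract[where cyl = cyl, OF j X fibrant_source[OF p Y] Kj] .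
  have jr: "j \<cdot> r \<in> hom M Z Z" using Comp_in_hom[OF r(1) j(1)] .
  have f: "p \<cdot> j \<in> hom M X Y" using Comp_in_hom[OF j(1) p(1)] .
  define e0 e1 s C where "e0 = cyl_in0 (cyl j)" and "e1 = cyl_in1 (cyl j)"
    and "s = cyl_proj (cyl j)" and "C = Tgt M (cyl_in0 (cyl j))"
  note e = rel_cylinder_ends[OF j(1) Kj, folded C_def, folded e0_def e1_def s_def]
  note eT = rel_cylinder_ends_TrivCof[OF j(1,2) Kj, folded e0_def e1_def]
  obtain G where G: "G \<in> hom M C Z" "G \<cdot> e0 = j \<cdot> r" "G \<cdot> e1 = Ident M Z"
    unfolding e0_def e1_def C_def using rel_homotopicE[OF r(3) jr] .
  show ?thesis
  proof (rule has_liftingI[OF i' p(1)])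
    fix u v assume u: "u \<in> hom M U Z" and v: "v \<in> hom M V Y" and uv: "p \<cdot> u = v \<cdot> i"
    \<comment> \<open>Pushing \<open>i\<close> out along \<open>u\<close> lets the homotopy \<open>G\<close> on \<open>Z\<close> itself be used, so that no
      cylinder on \<open>U\<close> is needed.\<close>
    obtain w b W where W: "is_pushout M u i w b" "w \<in> hom M Z W" "b \<in> hom M V W"
      using pushout_exists[OF u i'] .
    have wC: "w \<in> Cof M" using Cof_pushout[OF W(1) u i' W(2) i] .
    have wb: "w \<cdot> u = b \<cdot> i" using pushoutD(3)[OF W(1) u i'] .
    obtain v' where v': "v' \<in> hom M W Y" "v' \<cdot> w = p" "v' \<cdot> b = v"
      using pushout_desc[OF W(1) u i' W(2) p(1) v uv] .
    \<comment> \<open>A cylinder on \<open>W\<close> that extends the one on \<open>Z\<close>.\<close>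
    obtain E A0 a0 b0 d0 A1 a1 b1 d1 where
      0: "is_pushout M e0 w a0 b0" "a0 \<in> hom M C A0" "b0 \<in> hom M W A0"
        "d0 \<in> hom M A0 E" "d0 \<in> Cof M" "d0 \<in> Weq M"
      and 1: "is_pushout M e1 w a1 b1" "a1 \<in> hom M C A1" "b1 \<in> hom M W A1"
        "d1 \<in> hom M A1 E" "d1 \<in> Cof M" "d1 \<in> Weq M"
      and d: "d0 \<cdot> a0 = d1 \<cdot> a1"
      using glued_cylinder[OF e(1) eT(1,2) e(2) eT(3,4) e(4,7,8) W(2) wC] .
    have n0: "d0 \<cdot> b0 \<in> hom M W E" and n1: "d1 \<cdot> b1 \<in> hom M W E"
      and m: "d0 \<cdot> a0 \<in> hom M C E"
      using Comp_in_hom[OF 0(3,4)] Comp_in_hom[OF 1(3,4)] Comp_in_hom[OF 0(2,4)] .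
    have n0w: "(d0 \<cdot> b0) \<cdot> w = (d0 \<cdot> a0) \<cdot> e0"
      using Comp_assoc[OF W(2) 0(3,4)] Comp_assoc[OF e(1) 0(2,4)] pushoutD(3)[OF 0(1) e(1) W(2)]
      by metis
    have n1w: "(d1 \<cdot> b1) \<cdot> w = (d0 \<cdot> a0) \<cdot> e1"
      using Comp_assoc[OF W(2) 1(3,4)] Comp_assoc[OF e(2) 1(2,4)] pushoutD(3)[OF 1(1) e(2) W(2)] d
      by metis
    have pG: "p \<cdot> G \<in> hom M C Y" using Comp_in_hom[OF G(1) p(1)] .
    have "(p \<cdot> G) \<cdot> e1 = v' \<cdot> w"
      using Comp_assoc[OF e(2) G(1) p(1)] G(3) v'(2) Comp_Ident[OF p(1)] by metis
    \<comment> \<open>Homotopy extension from end 1: the map \<open>v'\<close> is carried along \<open>p G\<close> to \<open>y\<close> at end 0,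
      where it restricts to \<open>p j r\<close> on \<open>Z\<close>.\<close>
    then obtain H where H: "H \<in> hom M E Y" "H \<cdot> (d1 \<cdot> a1) = p \<cdot> G" "H \<cdot> (d1 \<cdot> b1) = v'"
      using extend_from_pushout[OF 1(1) e(2) W(2) 1(2,4-6) Y pG v'(1)] by blast
    define y where "y = H \<cdot> (d0 \<cdot> b0)"
    have y: "y \<in> hom M W Y" unfolding y_def using Comp_in_hom[OF n0 H(1)] .
    have yw: "y \<cdot> w = p \<cdot> (j \<cdot> r)"
      unfolding y_def
      using Comp_assoc[OF W(2) n0 H(1)] n0w Comp_assoc[OF e(1) m H(1)] d H(2)
        Comp_assoc[OF e(1) G(1) p(1)] G(2) by metis
    have ru: "r \<cdot> u \<in> hom M U X" using Comp_in_hom[OF u r(1)] .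
    have yb: "y \<cdot> b \<in> hom M V Y" using Comp_in_hom[OF W(3) y] .
    \<comment> \<open>The deformed problem \<open>(r u, y b)\<close> is one for \<open>p j\<close>, so the hypothesis applies.\<close>
    have "(p \<cdot> j) \<cdot> (r \<cdot> u) = (y \<cdot> b) \<cdot> i"
      using Comp_assoc[OF ru j(1) p(1)] Comp_assoc[OF u r(1) j(1)] Comp_assoc[OF i' W(3) y]
        Comp_assoc[OF u W(2) y] wb yw Comp_assoc[OF u jr p(1)] by metis
    then obtain k where k: "k \<in> hom M V X" "k \<cdot> i = r \<cdot> u"
      "rel_homotopic M cyl i ((p \<cdot> j) \<cdot> k) (y \<cdot> b)"
      using lift ru yb
      unfolding has_rlp_upto_homotopy_def homD(2,3)[OF i'] homD(2,3)[OF f] by blast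
    define c0 c1 D where "c0 = cyl_in0 (cyl i)" and "c1 = cyl_in1 (cyl i)"
      and "D = Tgt M (cyl_in0 (cyl i))"
    note c = rel_cylinder_ends[OF i' Ki, folded D_def, folded c0_def c1_def]
    note cT = rel_cylinder_ends_TrivCof[OF i' i Ki, folded c0_def c1_def]
    have jk: "j \<cdot> k \<in> hom M V Z" using Comp_in_hom[OF k(1) j(1)] .
    obtain h where h: "h \<in> hom M D Y" "h \<cdot> c0 = p \<cdot> (j \<cdot> k)" "h \<cdot> c1 = y \<cdot> b"
      using rel_homotopicE[OF k(3) Comp_in_hom[OF k(1) f]] Comp_assoc[OF k(1) j(1) p(1)]
      unfolding c0_def c1_def D_def by metis
    \<comment> \<open>Lifting the homotopy from \<open>p j k\<close> to \<open>y b\<close> turns \<open>j k\<close> into a strict lift \<open>g c\<^sub>1\<close>. It still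
      restricts to \<open>j r u\<close> on \<open>U\<close> since the homotopy is relative to \<open>i\<close>.\<close>
    obtain g where g: "g \<in> hom M D Z" "g \<cdot> c0 = j \<cdot> k" "p \<cdot> g = h"
      using lift_in_square[OF lift_TrivCof_Fib[OF cT(1,2) p(2)] c(1) p(1) jk h(1) h(2)[symmetric]] .
    have l: "g \<cdot> c1 \<in> hom M V Z" "p \<cdot> (g \<cdot> c1) = y \<cdot> b"
      using Comp_in_hom[OF c(2) g(1)] Comp_assoc[OF c(2) g(1) p(1)] g(3) h(3) by auto
    have li: "(j \<cdot> r) \<cdot> u = (g \<cdot> c1) \<cdot> i"
      using Comp_assoc[OF i' c(2) g(1)] Comp_assoc[OF i' c(1) g(1)] c(3) g(2)
        Comp_assoc[OF i' k(1) j(1)] k(2) Comp_assoc[OF u r(1) j(1)] by metis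
    obtain z where z: "z \<in> hom M W Z" "z \<cdot> w = j \<cdot> r" "z \<cdot> b = g \<cdot> c1"
      using pushout_desc[OF W(1) u i' W(2) jr l(1) li] .
    have pz: "p \<cdot> z = y"
      by (rule pushout_ext[OF W(1) u i' W(2) Comp_in_hom[OF z(1) p(1)] y])
        (simp_all add: Comp_assoc[OF W(2) z(1) p(1)] Comp_assoc[OF W(3) z(1) p(1)] z yw l(2))
    \<comment> \<open>Homotopy lifting from end 0 brings the lift \<open>z\<close> of \<open>y\<close> back to a lift of \<open>v'\<close> at end 1,
      where \<open>G\<close> is the identity.\<close>
    have "G \<cdot> e0 = z \<cdot> w" using G(2) z(2) by simp
    moreover have "H \<cdot> (d0 \<cdot> a0) = p \<cdot> G" using d H(2) by simp
    moreover have "H \<cdot> (d0 \<cdot> b0) = p \<cdot> z" using pz y_def by simp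
    ultimately obtain L where L: "L \<in> hom M E Z" "L \<cdot> (d0 \<cdot> a0) = G" "p \<cdot> L = H"
      using lift_from_pushout[OF 0(1) e(1) W(2) 0(2,4-6) p G(1) z(1) _ H(1)] by metis
    define t where "t = L \<cdot> (d1 \<cdot> b1)"
    have t: "t \<in> hom M W Z" unfolding t_def using Comp_in_hom[OF n1 L(1)] .
    have pt: "p \<cdot> t = v'"
      unfolding t_def using Comp_assoc[OF n1 L(1) p(1)] L(3) H(3) by metis
    have tw: "t \<cdot> w = Ident M Z"
      unfolding t_def
      using Comp_assoc[OF W(2) n1 L(1)] n1w Comp_assoc[OF e(2) m L(1)] L(2) G(3) by metis
    have "(t \<cdot> b) \<cdot> i = u"
      using Comp_assoc[OF i' W(3) t] Comp_assoc[OF u W(2) t] wb tw Ident_Comp[OF u] by metis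
    moreover have "p \<cdot> (t \<cdot> b) = v"
      using Comp_assoc[OF W(3) t p(1)] pt v'(3) by metis
    ultimately show "\<exists>h\<in>hom M V Z. h \<cdot> i = u \<and> p \<cdot> h = v"
      using Comp_in_hom[OF W(3) t] by blast
  qed
qed

end

lemma generators_subset_cof_class: "I \<subseteq> Arr C \<Longrightarrow> I \<subseteq> cof_class C I"
  unfolding cof_class_def inj_class_def llp_def rlp_def by blast

lemma rlp_cof_class: "I \<subseteq> Arr C \<Longrightarrow> rlp C (cof_class C I) = rlp C I"
  unfolding cof_class_def inj_class_def llp_def rlp_def by blast

text \<open>
  In a factorization into a trivial cofibration and a fibration \<open>p\<close>, the map \<open>p\<close> is injective
  with respect to the generators. As the generators determine the cofibrations, such maps are
  exactly the trivial fibrations.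
\<close>
lemma (in infinitary_model_category) Weq_if_rlp_upto_homotopy:
  assumes cyl: "rel_cylinder_choice M cyl"
    and I: "I \<subseteq> Arr M" "cof_class M I = Cof M"
    and f: "f \<in> hom M X Y" and X: "fibrant M X" and Y: "fibrant M Y"
    and lift: "\<And>i. i \<in> I \<Longrightarrow> has_rlp_upto_homotopy M cyl f i"
  shows "f \<in> Weq M"
proof -
  obtain j p Z where jp: "j \<in> hom M X Z" "p \<in> hom M Z Y" "p \<cdot> j = f"
    "j \<in> Cof M" "j \<in> Weq M" "p \<in> Fib M"
    using factor_TrivCof_Fib[OF f] .
  have "has_lifting M i p" if "i \<in> I" for i
    using homotopy_lift_imp_lift[OF cyl jp(1,4,5,2,6) X Y] lift[OF that] jp(3)
      generators_subset_cof_class[OF I(1)] I(2) that by auto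
  then have "p \<in> rlp M I" unfolding rlp_def using homD(1)[OF jp(2)] by blast
  then have "p \<in> Weq M" using rlp_cof_class[OF I(1)] I(2) TrivFib_eq by auto
  then show ?thesis using Weq_Comp[OF jp(1,2,5)] jp(3) by simp
qed

theorem proposition3p5:
  fixes \<kappa> :: "'k rel"
    and M :: "('o, 'm) model_cat"
    and cyl :: "'m \<Rightarrow> 'm rel_cylinder"
    and I :: "'m set"
    and f :: 'm and X Y :: 'o
  assumes "Card_order \<kappa>" and "cinfinite \<kappa>"
    and "model_category \<kappa> M"
    and "rel_cylinder_choice M cyl"
    and "I \<subseteq> Arr M" and "cof_class M I = Cof M"
    and "f \<in> hom M X Y" and "fibrant M X" and "fibrant M Y"
  shows "(f \<in> Weq M \<longleftrightarrow> (\<forall>i\<in>Cof M. has_rlp_upto_homotopy M cyl f i)) \<and>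
         ((\<forall>i\<in>Cof M. has_rlp_upto_homotopy M cyl f i) \<longleftrightarrow>
          (\<forall>i\<in>I. has_rlp_upto_homotopy M cyl f i))"
proof -
  interpret infinitary_model_category \<kappa> M
    using assms(1-3) by (simp add: infinitary_model_category_def infinitary_model_category_axioms_def)
  have "\<forall>i\<in>Cof M. has_rlp_upto_homotopy M cyl f i" if "f \<in> Weq M"
    using Weq_has_rlp_upto_homotopy[OF assms(4,7) that assms(8,9)] by blast
  moreover have "\<forall>i\<in>I. has_rlp_upto_homotopy M cyl f i"
    if "\<forall>i\<in>Cof M. has_rlp_upto_homotopy M cyl f i"
    using that generators_subset_cof_class[OF assms(5)] assms(6) by auto
  moreover have "f \<in> Weq M" if "\<forall>i\<in>I. has_rlp_upto_homotopy M cyl f i"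
    using Weq_if_rlp_upto_homotopy[OF assms(4-9)] that by blast
  ultimately show ?thesis by blast
qed

end
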